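(* Let $\alpha>0$ and $\ln 2>\epsilon>0$. In the two-database setting, given side information $(Q_0,Q_1)$, any $\epsilon$-pDP property tester with proximity parameter $\alpha$ has query complexity \[\Omega\left(\frac{1}{\beta\alpha^2}\right),\] where $\beta=\min_{D\in\{0,1\}}\min_{i\in[n]}P_D(i)$.
   Context: An algorithm in the two-database setting is a pair $\mathcal{A}=(P_0,P_1)$ of probability distributions on $[n]=\{1,\dots,n\}$: it accepts two (neighbouring) databases $0,1$, and querying database $i$ returns an independent sample from $P_i$. With $D_\infty(P,Q)=\sup_E\ln\frac{P(E)}{Q(E)}$ (supremum over events), $\mathcal{A}$ is $\epsilon$-pDP (pure differentially private) if $D_\infty(P_0,P_1)\le\epsilon$ and $D_\infty(P_1,P_0)\le\epsilon$. $\mathcal{A}$ is $\alpha$-far from $\epsilon$-pDP if $|\epsilon'-\epsilon|>\alpha$ for every $\epsilon'$ such that $\mathcal{A}$ is $\epsilon'$-pDP (in particular if there is no such $\epsilon'$). An $\epsilon$-pDP property tester with side information $(Q_0,Q_1)$ (full-information setting), proximity parameter $\alpha$ and query complexity $r$ per database is given the explicit (untrusted) pair of distributions $(Q_0,Q_1)$ on $[n]$, purported to equal $(P_0,P_1)$, and $r$ independent samples from each of the unknown $P_0,P_1$; it ACCEPTS with probability at least $2/3$ if $(P_0,P_1)$ is $\epsilon$-pDP and $P_0=Q_0$, $P_1=Q_1$, and REJECTS with probability at least $2/3$ if $(P_0,P_1)$ is $\alpha$-far from $\epsilon$-pDP.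
   Formalization: The bound is worst-case: for each n≥2 and β>0 with β(n−1+e^ε)≤1, some ε-pDP side information (Q0,Q1) with minimum mass β is hard for every tester; for all (Q0,Q1), e.g. Q0=Q1 uniform with α→0, it fails. *)

theory Defs
  imports "HOL-Probability.Probability"
begin

definition distribution_on :: "nat \<Rightarrow> nat pmf \<Rightarrow> bool" where
  "distribution_on n P \<longleftrightarrow> set_pmf P \<subseteq> {1..n}"

(* ln (p / q) for probabilities p and q, with ln 0 = -\<infinity> and ln (p / 0) = \<infinity> for p > 0;
   an event that is null under both distributions is ignored (0 / 0 counts as 0). *)
definition ln_ratio :: "real \<Rightarrow> real \<Rightarrow> ereal" where
  "ln_ratio p q = (if p = 0 then -\<infinity> else if q = 0 then \<infinity> else ereal (ln (p / q)))"

definition max_divergence :: "'a pmf \<Rightarrow> 'a pmf \<Rightarrow> ereal" where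
  "max_divergence P Q = (SUP E. ln_ratio (measure_pmf.prob P E) (measure_pmf.prob Q E))"

definition pure_dp :: "real \<Rightarrow> 'a pmf \<Rightarrow> 'a pmf \<Rightarrow> bool" where
  "pure_dp \<epsilon> P0 P1 \<longleftrightarrow>
     max_divergence P0 P1 \<le> ereal \<epsilon> \<and> max_divergence P1 P0 \<le> ereal \<epsilon>"

definition far_from_pure_dp :: "real \<Rightarrow> real \<Rightarrow> 'a pmf \<Rightarrow> 'a pmf \<Rightarrow> bool" where
  "far_from_pure_dp \<alpha> \<epsilon> P0 P1 \<longleftrightarrow>
     (\<forall>\<epsilon>'. pure_dp \<epsilon>' P0 P1 \<longrightarrow> \<bar>\<epsilon>' - \<epsilon>\<bar> > \<alpha>)"

(* The tester T maps the two sample lists to a distribution over verdicts (True means ACCEPT),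
   so it may use internal randomness. *)
definition verdict ::
  "(nat list \<Rightarrow> nat list \<Rightarrow> bool pmf) \<Rightarrow> nat \<Rightarrow> nat pmf \<Rightarrow> nat pmf \<Rightarrow> bool pmf" where
  "verdict T r P0 P1 =
     bind_pmf (replicate_pmf r P0) (\<lambda>xs. bind_pmf (replicate_pmf r P1) (\<lambda>ys. T xs ys))"

(* The side information (Q0, Q1) is known explicitly, so both T and r may depend on it;
   the sampled distributions P0 and P1 are unknown. *)
definition pure_dp_tester ::
  "nat \<Rightarrow> real \<Rightarrow> real \<Rightarrow> nat pmf \<Rightarrow> nat pmf \<Rightarrow> nat \<Rightarrow>
   (nat list \<Rightarrow> nat list \<Rightarrow> bool pmf) \<Rightarrow> bool" where
  "pure_dp_tester n \<epsilon> \<alpha> Q0 Q1 r T \<longleftrightarrow>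
     (\<forall>P0 P1. distribution_on n P0 \<and> distribution_on n P1 \<longrightarrow>
        (pure_dp \<epsilon> P0 P1 \<and> P0 = Q0 \<and> P1 = Q1 \<longrightarrow> pmf (verdict T r P0 P1) True \<ge> 2 / 3) \<and>
        (far_from_pure_dp \<alpha> \<epsilon> P0 P1 \<longrightarrow> pmf (verdict T r P0 P1) False \<ge> 2 / 3))"

definition min_prob :: "nat \<Rightarrow> nat pmf \<Rightarrow> nat pmf \<Rightarrow> real" where
  "min_prob n P0 P1 = min (MIN i\<in>{1..n}. pmf P0 i) (MIN i\<in>{1..n}. pmf P1 i)"

end

theory Submission
  imports Defs
begin

text \<open>
  Le Cam's two-point method. The trusted pair \<open>(Q0, Q1)\<close> is exactly \<open>\<epsilon>\<close>-private because of a
  single point of mass \<open>\<beta>\<close> under \<open>Q0\<close> and mass \<open>\<beta> * exp \<epsilon>\<close> under \<open>Q1\<close>. Moving a fraction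
  \<open>min 1 \<alpha>\<close> of that mass \<open>\<beta>\<close> to another point of \<open>Q0\<close> makes the pair \<open>\<alpha>\<close>-far from private,
  while the perturbed distribution is at chi-square distance at most \<open>2 * \<beta> * \<alpha>\<^sup>2\<close> from \<open>Q0\<close>.
  The second moment of the likelihood ratio is multiplicative over independent samples, so two
  product measures that a test can separate need a number of samples of the order of the inverse
  chi-square distance.
\<close>

section \<open>Distinguishing product measures\<close>

lemma finite_set_replicate_pmf:
  assumes "finite (set_pmf P)"
  shows "finite (set_pmf (replicate_pmf r P))"
proof -
  have "set_pmf (replicate_pmf r P) = {xs. set xs \<subseteq> set_pmf P \<and> length xs = r}"
    by (auto simp: set_replicate_pmf)
  then show ?thesis
    using assms by (simp add: finite_lists_length_eq)
qed

text \<open>Independence of the samples. Applied to the squared likelihood ratio of one sample, it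
  yields the second moment of the ratio of the products.\<close>

lemma expectation_replicate_pmf_prod_list:
  fixes h :: "'a \<Rightarrow> real"
  assumes "finite (set_pmf Q)"
  shows "measure_pmf.expectation (replicate_pmf r Q) (\<lambda>xs. prod_list (map h xs)) =
         measure_pmf.expectation Q h ^ r"
proof (induction r)
  case 0
  then show ?case by simp
next
  case (Suc r)
  have fin: "finite (set_pmf (replicate_pmf r Q))"
    using assms by (rule finite_set_replicate_pmf)
  have bind: "replicate_pmf (Suc r) Q = bind_pmf Q (\<lambda>x. map_pmf ((#) x) (replicate_pmf r Q))"
    by (simp add: map_pmf_def)
  have "measure_pmf.expectation (replicate_pmf (Suc r) Q) (\<lambda>xs. prod_list (map h xs)) =
        (\<Sum>x\<in>set_pmf Q. pmf Q x * (h x * measure_pmf.expectation Q h ^ r))"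
    unfolding bind using assms fin
    by (subst pmf_expectation_bind[where A = "set_pmf Q"]) (simp_all add: Suc)
  also have "\<dots> = measure_pmf.expectation Q h ^ Suc r"
    using integral_measure_pmf_real[of "set_pmf Q" Q h] assms
    by (simp add: sum_distrib_right mult_ac)
  finally show ?case .
qed

lemma pmf_replicate_pmf_Cons:
  "pmf (replicate_pmf (Suc r) P) (x # xs) = pmf P x * pmf (replicate_pmf r P) xs"
proof -
  have "replicate_pmf (Suc r) P = map_pmf (\<lambda>(x, xs). x # xs) (pair_pmf P (replicate_pmf r P))"
    by (simp add: pair_pmf_def map_bind_pmf)
  also have "pmf \<dots> ((\<lambda>(x, xs). x # xs) (x, xs)) = pmf (pair_pmf P (replicate_pmf r P)) (x, xs)"
    by (rule pmf_map_inj') (auto simp: inj_on_def)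
  finally show ?thesis
    by (simp add: pmf_pair)
qed

text \<open>Where \<open>pmf Q y = 0\<close> the quotient defaults to 0, which is harmless because
  the support inclusion makes \<open>pmf P y\<close> vanish too. Lists whose length is not
  \<open>r\<close> have mass 0 on both sides.\<close>

lemma pmf_replicate_pmf_ratio:
  assumes "set_pmf P \<subseteq> set_pmf Q"
  shows "pmf (replicate_pmf r P) xs =
         pmf (replicate_pmf r Q) xs * prod_list (map (\<lambda>x. pmf P x / pmf Q x) xs)"
proof (induction r arbitrary: xs)
  case 0
  then show ?case by (cases xs) (simp_all add: indicator_def)
next
  case (Suc r)
  show ?case
  proof (cases xs)
    case Nil
    have "pmf (replicate_pmf (Suc r) R) [] = 0" for R :: "'a pmf"
      by (simp add: pmf_eq_0_set_pmf set_replicate_pmf del: replicate_pmf.simps)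
    then show ?thesis
      by (simp add: Nil del: replicate_pmf.simps)
  next
    case (Cons y ys)
    have "pmf Q y = 0 \<Longrightarrow> pmf P y = 0"
      using assms by (auto simp: pmf_eq_0_set_pmf)
    then show ?thesis
      unfolding Cons pmf_replicate_pmf_Cons list.map prod_list.Cons Suc[of ys]
      by (cases "pmf Q y = 0") simp_all
  qed
qed

text \<open>Change of measure, so that a test can be compared under both hypotheses within a single
  expectation.\<close>

lemma expectation_replicate_pmf_change:
  fixes g :: "'a list \<Rightarrow> real"
  assumes "set_pmf P \<subseteq> set_pmf Q" and fin: "finite (set_pmf Q)"
  shows "measure_pmf.expectation (replicate_pmf r P) g =
         measure_pmf.expectation (replicate_pmf r Q)
           (\<lambda>xs. g xs * prod_list (map (\<lambda>x. pmf P x / pmf Q x) xs))"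
proof -
  have S: "finite (set_pmf (replicate_pmf r Q))"
    using fin by (rule finite_set_replicate_pmf)
  have sub: "set_pmf (replicate_pmf r P) \<subseteq> set_pmf (replicate_pmf r Q)"
    using assms(1) by (auto simp: set_replicate_pmf)
  show ?thesis
    using sub
    by (subst (1 2) integral_measure_pmf_real[OF S])
      (auto simp: pmf_replicate_pmf_ratio[OF assms(1)] intro!: sum.cong)
qed

text \<open>The excess over 1 is the chi-square divergence: p^2/q = (p - q)^2/q + 2p - q, and both p
  and q sum to 1 over the support of \<open>Q\<close>.\<close>

lemma expectation_likelihood_ratio_power2:
  assumes sub: "set_pmf P \<subseteq> set_pmf Q" and fin: "finite (set_pmf Q)"
  shows "measure_pmf.expectation Q (\<lambda>x. (pmf P x / pmf Q x)\<^sup>2) =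
         1 + (\<Sum>x\<in>set_pmf Q. (pmf P x - pmf Q x)\<^sup>2 / pmf Q x)"
proof -
  have P1: "(\<Sum>x\<in>set_pmf Q. pmf P x) = 1"
    using sum_pmf_eq_1[OF fin sub] .
  have Q1: "(\<Sum>x\<in>set_pmf Q. pmf Q x) = 1"
    using sum_pmf_eq_1[OF fin] by simp
  have "measure_pmf.expectation Q (\<lambda>x. (pmf P x / pmf Q x)\<^sup>2) =
        (\<Sum>x\<in>set_pmf Q. (pmf P x / pmf Q x)\<^sup>2 * pmf Q x)"
    by (subst integral_measure_pmf_real[OF fin]) auto
  also have "\<dots> = (\<Sum>x\<in>set_pmf Q. (pmf P x - pmf Q x)\<^sup>2 / pmf Q x + 2 * pmf P x - pmf Q x)"
    by (intro sum.cong refl) (simp add: field_simps power2_eq_square set_pmf_iff)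
  also have "\<dots> = 1 + (\<Sum>x\<in>set_pmf Q. (pmf P x - pmf Q x)\<^sup>2 / pmf Q x)"
    by (simp add: sum.distrib sum_subtractf sum_distrib_left[symmetric] P1 Q1)
  finally show ?thesis .
qed

text \<open>\<open>f\<close> is the acceptance probability of a randomised test. With L the
  likelihood ratio of the samples and D the chi-square sum, f (1 - L) has mean at least 1/3 under
  the product of \<open>Q\<close>, while (1 - L)^2 has mean (1 + D)^r - 1, at most exp (r D) -
  1.\<close>

lemma sample_size_ge_chi_square:
  fixes f :: "'a list \<Rightarrow> real"
  assumes sub: "set_pmf P \<subseteq> set_pmf Q" and fin: "finite (set_pmf Q)"
    and f: "\<And>xs. 0 \<le> f xs" "\<And>xs. f xs \<le> 1"
    and EQ: "measure_pmf.expectation (replicate_pmf r Q) f \<ge> 2 / 3"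
    and EP: "measure_pmf.expectation (replicate_pmf r P) f \<le> 1 / 3"
  shows "real r * (\<Sum>x\<in>set_pmf Q. (pmf P x - pmf Q x)\<^sup>2 / pmf Q x) \<ge> 1 / 10"
proof -
  define D where "D = (\<Sum>x\<in>set_pmf Q. (pmf P x - pmf Q x)\<^sup>2 / pmf Q x)"
  define L where "L = (\<lambda>xs. prod_list (map (\<lambda>x. pmf P x / pmf Q x) xs))"
  let ?M = "measure_pmf (replicate_pmf r Q)"
  have S: "finite (set_pmf (replicate_pmf r Q))"
    using fin by (rule finite_set_replicate_pmf)
  have int [simp]: "integrable ?M g" for g :: "'a list \<Rightarrow> real"
    using S by (rule integrable_measure_pmf_finite)
  have EL: "integral\<^sup>L ?M L = 1"
    using expectation_replicate_pmf_change[OF sub fin, of r "\<lambda>_. 1"] by (simp add: L_def)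
  have "(L xs)\<^sup>2 = prod_list (map (\<lambda>x. (pmf P x / pmf Q x)\<^sup>2) xs)" for xs
    unfolding L_def by (induction xs) (simp_all add: power_mult_distrib power_divide)
  then have EL2: "integral\<^sup>L ?M (\<lambda>xs. (L xs)\<^sup>2) = (1 + D) ^ r"
    by (simp only: expectation_replicate_pmf_prod_list[OF fin]
        expectation_likelihood_ratio_power2[OF sub fin] D_def)
  have EfL: "integral\<^sup>L ?M (\<lambda>xs. f xs * L xs) \<le> 1 / 3"
    using EP unfolding L_def expectation_replicate_pmf_change[OF sub fin] .
  \<comment> \<open>Linearised Cauchy-Schwarz: |t| <= 1/6 + 3/2 t^2 restates (|t| - 1/3)^2 >= 0,
    with equality at the gap 1/3 = 2/3 - 1/3.\<close>
  have "f xs - f xs * L xs \<le> 1 / 6 + 3 / 2 * (1 - 2 * L xs + (L xs)\<^sup>2)" for xs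
  proof -
    have "f xs - f xs * L xs \<le> \<bar>f xs * (1 - L xs)\<bar>"
      by (simp add: algebra_simps)
    also have "\<dots> \<le> \<bar>1 - L xs\<bar>"
      using f[of xs] by (simp add: abs_mult mult_left_le_one_le)
    also have "\<dots> \<le> 1 / 6 + 3 / 2 * (1 - L xs)\<^sup>2"
      using zero_le_power2[of "\<bar>1 - L xs\<bar> - 1 / 3"] by (simp add: power2_diff field_simps)
    finally show ?thesis
      by (simp add: power2_diff algebra_simps)
  qed
  then have "integral\<^sup>L ?M (\<lambda>xs. f xs - f xs * L xs) \<le>
      integral\<^sup>L ?M (\<lambda>xs. 1 / 6 + 3 / 2 * (1 - 2 * L xs + (L xs)\<^sup>2))"
    by (intro integral_mono) simp_all
  then have "integral\<^sup>L ?M f - integral\<^sup>L ?M (\<lambda>xs. f xs * L xs) \<le> 1 / 6 + 3 / 2 * ((1 + D) ^ r - 1)"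
    by (simp add: EL EL2)
  \<comment> \<open>Solves 1/3 <= 1/6 + 3/2 (X - 1) for X.\<close>
  then have "10 / 9 \<le> (1 + D) ^ r"
    using EQ EfL by argo
  also have "\<dots> \<le> exp D ^ r"
    by (intro power_mono) (auto simp: D_def intro!: exp_ge_add_one_self add_nonneg_nonneg sum_nonneg)
  also have "\<dots> = exp (real r * D)"
    by (simp add: exp_of_nat_mult)
  finally have "ln (10 / 9) \<le> real r * D"
    by (metis exp_gt_zero ln_exp ln_le_cancel_iff zero_less_divide_iff zero_less_numeral)
  moreover have "1 / 10 \<le> ln (10 / 9 :: real)"
    using ln_le_minus_one[of "9 / 10 :: real"] by (simp add: ln_div field_simps)
  ultimately show ?thesis
    by (simp add: D_def)
qed

section \<open>Privacy of discrete distributions\<close>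

text \<open>Summing the pointwise bound extends it to events. It also forces Q(E) > 0 whenever P(E)
  > 0, so the infinite case of \<open>ln_ratio\<close> never arises.\<close>

lemma max_divergence_le:
  assumes "\<And>x. pmf P x \<le> exp \<epsilon> * pmf Q x"
  shows "max_divergence P Q \<le> ereal \<epsilon>"
  unfolding max_divergence_def
proof (rule SUP_least)
  fix E
  have "measure_pmf.prob P E \<le> infsetsum (\<lambda>x. exp \<epsilon> * pmf Q x) E"
    unfolding measure_pmf_conv_infsetsum using assms
    by (intro infsetsum_mono abs_summable_on_cmult_right pmf_abs_summable)
  then have le: "measure_pmf.prob P E \<le> exp \<epsilon> * measure_pmf.prob Q E"
    by (simp add: measure_pmf_conv_infsetsum infsetsum_cmult_right pmf_abs_summable)
  show "ln_ratio (measure_pmf.prob P E) (measure_pmf.prob Q E) \<le> ereal \<epsilon>"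
  proof (cases "measure_pmf.prob P E = 0")
    case False
    then have P: "measure_pmf.prob P E > 0"
      by (simp add: zero_less_measure_iff)
    then have Q: "measure_pmf.prob Q E > 0"
      using le by (metis exp_gt_zero less_le_trans zero_less_mult_pos)
    have "ln (measure_pmf.prob P E / measure_pmf.prob Q E) \<le> ln (exp \<epsilon>)"
      using P Q le by (subst ln_le_cancel_iff) (simp_all add: divide_simps)
    then show ?thesis
      using P Q by (simp add: ln_ratio_def)
  qed (simp add: ln_ratio_def)
qed

text \<open>The event {x} is a sufficient witness, in the direction of Q against P. If \<alpha> >=
  1, then P(x) = 0 < Q(x) and no finite privacy level exists; otherwise the log ratio is \<epsilon>
  - ln (1 - \<alpha>).\<close>

lemma far_from_pure_dpI:
  assumes P: "pmf P x = (1 - min 1 \<alpha>) * p" and Q: "pmf Q x = p * exp \<epsilon>"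
    and "p > 0" "\<alpha> > 0"
  shows "far_from_pure_dp \<alpha> \<epsilon> P Q"
  unfolding far_from_pure_dp_def
proof (intro allI impI)
  fix \<epsilon>' assume "pure_dp \<epsilon>' P Q"
  then have "(SUP E. ln_ratio (measure_pmf.prob Q E) (measure_pmf.prob P E)) \<le> ereal \<epsilon>'"
    by (simp add: pure_dp_def max_divergence_def)
  then have "ln_ratio (measure_pmf.prob Q {x}) (measure_pmf.prob P {x}) \<le> ereal \<epsilon>'"
    by (meson SUP_le_iff UNIV_I)
  then have le: "ln_ratio (p * exp \<epsilon>) ((1 - min 1 \<alpha>) * p) \<le> ereal \<epsilon>'"
    by (simp add: measure_pmf_single P Q)
  have \<alpha>: "\<alpha> < 1"
    using le \<open>p > 0\<close> by (cases "\<alpha> < 1") (auto simp: ln_ratio_def)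
  then have "ln (p * exp \<epsilon> / ((1 - \<alpha>) * p)) \<le> \<epsilon>'"
    using le \<open>p > 0\<close> by (simp add: ln_ratio_def)
  also have "p * exp \<epsilon> / ((1 - \<alpha>) * p) = exp \<epsilon> / (1 - \<alpha>)"
    using \<open>p > 0\<close> by simp
  finally have "\<epsilon> - ln (1 - \<alpha>) \<le> \<epsilon>'"
    using \<alpha> by (simp add: ln_div)
  \<comment> \<open>Being far demands a strict inequality, hence the equality case of ln x <= x - 1
    is excluded as well.\<close>
  moreover have "ln (1 - \<alpha>) < - \<alpha>"
    using ln_le_minus_one[of "1 - \<alpha>"] ln_eq_minus_one[of "1 - \<alpha>"] \<alpha> \<open>\<alpha> > 0\<close> by fastforce
  ultimately show "\<bar>\<epsilon>' - \<epsilon>\<bar> > \<alpha>"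
    by linarith
qed

section \<open>The hard instance\<close>

text \<open>Point 1 carries the adjustable mass \<open>a\<close> and point 2 absorbs the remainder,
  so one family provides \<open>Q0\<close>, \<open>Q1\<close> and the perturbed
  \<open>P0\<close>.\<close>

definition near_uniform :: "nat \<Rightarrow> real \<Rightarrow> real \<Rightarrow> nat \<Rightarrow> real" where
  "near_uniform n \<beta> a i =
     (if i = 1 then a else if i = 2 then 1 - (real n - 2) * \<beta> - a
      else if i \<in> {3..n} then \<beta> else 0)"

lemma atLeastAtMost_split_1_2: "n \<ge> 2 \<Longrightarrow> {1..n} = insert 1 (insert 2 {3..n :: nat})"
  by auto

lemma ex_pmf_near_uniform:
  assumes "n \<ge> 2" "0 \<le> a" "0 \<le> \<beta>" "a + (real n - 2) * \<beta> \<le> 1"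
  obtains P where "pmf P = near_uniform n \<beta> a" "distribution_on n P"
proof -
  define w where "w = near_uniform n \<beta> a"
  have nonneg: "w i \<ge> 0" for i
    using assms by (auto simp: w_def near_uniform_def)
  have outside: "w i = 0" if "i \<notin> {1..n}" for i
    using that assms(1) by (auto simp: w_def near_uniform_def)
  have "(\<Sum>i\<in>{3..n}. w i) = (\<Sum>i\<in>{3..n}. \<beta>)"
    by (intro sum.cong) (auto simp: w_def near_uniform_def)
  then have "(\<Sum>i\<in>{1..n}. w i) = 1"
    using assms(1) unfolding atLeastAtMost_split_1_2[OF assms(1)]
    by (simp add: of_nat_diff) (simp add: w_def near_uniform_def)
  moreover have "(\<integral>\<^sup>+i. ennreal (w i) \<partial>count_space UNIV) = (\<Sum>i\<in>{1..n}. ennreal (w i))"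
    using outside by (intro nn_integral_count_space'[of "{1..n}"]) (force intro: nonneg)+
  ultimately have "(\<integral>\<^sup>+i. ennreal (w i) \<partial>count_space UNIV) = 1"
    using nonneg by (simp add: sum_ennreal)
  then have pmf: "pmf (embed_pmf w) = w"
    using nonneg by (simp add: pmf_embed_pmf fun_eq_iff)
  show thesis
  proof
    show "pmf (embed_pmf w) = near_uniform n \<beta> a"
      using pmf by (simp add: w_def)
    show "distribution_on n (embed_pmf w)"
      unfolding distribution_on_def using pmf outside by (metis set_pmf_iff subsetI)
  qed
qed

theorem theorem18:
  shows "\<exists>c::real. c > 0 \<and>
    (\<forall>(n::nat) (\<epsilon>::real) (\<alpha>::real) (\<beta>::real).
       n \<ge> 2 \<and> 0 < \<epsilon> \<and> \<epsilon> < ln 2 \<and> \<alpha> > 0 \<and> \<beta> > 0 \<and> \<beta> * (real n - 1 + exp \<epsilon>) \<le> 1 \<longrightarrow>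
       (\<exists>Q0 Q1. distribution_on n Q0 \<and> distribution_on n Q1 \<and> pure_dp \<epsilon> Q0 Q1 \<and>
          min_prob n Q0 Q1 = \<beta> \<and>
          (\<forall>r T. pure_dp_tester n \<epsilon> \<alpha> Q0 Q1 r T \<longrightarrow> real r \<ge> c / (\<beta> * \<alpha>\<^sup>2))))"
\<comment> \<open>The bound 1/10 of \<open>sample_size_ge_chi_square\<close>, divided by the factor
  2 of the chi-square estimate.\<close>
proof (intro exI[of _ "1 / 20"] conjI allI impI; (elim conjE)?)
  show "(1 / 20 :: real) > 0" by simp
next
  fix n :: nat and \<epsilon> \<alpha> \<beta> :: real
  assume n: "n \<ge> 2" and \<epsilon>: "0 < \<epsilon>" and \<alpha>: "\<alpha> > 0" and \<beta>: "\<beta> > 0"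
    and "\<beta> * (real n - 1 + exp \<epsilon>) \<le> 1"
  \<comment> \<open>Equivalently, point 2 keeps mass at least \<beta> under
    \<open>Q1\<close>.\<close>
  then have room: "(real n - 2) * \<beta> + \<beta> * exp \<epsilon> + \<beta> \<le> 1"
    by (simp add: algebra_simps)
  have e: "\<beta> < \<beta> * exp \<epsilon>"
    using \<epsilon> \<beta> by simp
  \<comment> \<open>Truncated because point 1 has only mass \<beta> to give away.\<close>
  define \<eta> where "\<eta> = min 1 \<alpha>"
  have \<eta>: "0 < \<eta>" "\<eta> \<le> 1" "\<eta> \<le> \<alpha>"
    using \<alpha> by (auto simp: \<eta>_def)
  have loss: "0 \<le> (1 - \<eta>) * \<beta>" "(1 - \<eta>) * \<beta> \<le> \<beta>"
    using \<eta> \<beta> by (auto simp: mult_left_le_one_le)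
  have "0 \<le> \<beta>" "0 \<le> \<beta> * exp \<epsilon>" "\<beta> + (real n - 2) * \<beta> \<le> 1"
    "\<beta> * exp \<epsilon> + (real n - 2) * \<beta> \<le> 1" "(1 - \<eta>) * \<beta> + (real n - 2) * \<beta> \<le> 1"
    using \<beta> e room loss by linarith+
  note admissible = this
  obtain Q0 where Q0: "pmf Q0 = near_uniform n \<beta> \<beta>" "distribution_on n Q0"
    using ex_pmf_near_uniform[OF n admissible(1,1,3)] by blast
  obtain Q1 where Q1: "pmf Q1 = near_uniform n \<beta> (\<beta> * exp \<epsilon>)" "distribution_on n Q1"
    using ex_pmf_near_uniform[OF n admissible(2,1,4)] by blast
  obtain P0 where P0: "pmf P0 = near_uniform n \<beta> ((1 - \<eta>) * \<beta>)" "distribution_on n P0"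
    using ex_pmf_near_uniform[OF n loss(1) admissible(1,5)] by blast
  have bounds: "pmf Q0 i \<ge> \<beta>" "pmf Q1 i \<ge> \<beta>" if "i \<in> {1..n}" for i
    using that room e by (auto simp: Q0 Q1 near_uniform_def)
  have "pmf Q0 i \<le> exp \<epsilon> * pmf Q1 i" "pmf Q1 i \<le> exp \<epsilon> * pmf Q0 i" for i
  proof -
    \<comment> \<open>The mass of point 2 under \<open>Q1\<close>. Under \<open>Q0\<close> it is q +
      \<beta> (exp \<epsilon> - 1), at most q exp \<epsilon> since \<beta> <= q.\<close>
    define q where "q = 1 - (real n - 2) * \<beta> - \<beta> * exp \<epsilon>"
    have "\<beta> * (exp \<epsilon> - 1) \<le> q * (exp \<epsilon> - 1)"
      using room \<epsilon> by (intro mult_right_mono) (auto simp: q_def)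
    then have "1 - (real n - 2) * \<beta> - \<beta> \<le> exp \<epsilon> * q"
      by (simp add: q_def algebra_simps)
    moreover have "q \<le> exp \<epsilon> * (1 - (real n - 2) * \<beta> - \<beta>)"
    proof -
      have "q \<le> 1 * (1 - (real n - 2) * \<beta> - \<beta>)"
        using e by (simp add: q_def)
      also have "\<dots> \<le> exp \<epsilon> * (1 - (real n - 2) * \<beta> - \<beta>)"
        using \<epsilon> \<beta> e room by (intro mult_right_mono) (simp, linarith)
      finally show ?thesis .
    qed
    moreover have "\<beta> \<le> exp \<epsilon> * \<beta>" "\<beta> \<le> exp \<epsilon> * (\<beta> * exp \<epsilon>)"
    proof -
      show "\<beta> \<le> exp \<epsilon> * \<beta>"
        using e by (simp add: mult.commute)
      also have "\<dots> \<le> exp \<epsilon> * (\<beta> * exp \<epsilon>)"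
        using e by simp
      finally show "\<beta> \<le> exp \<epsilon> * (\<beta> * exp \<epsilon>)" .
    qed
    ultimately show "pmf Q0 i \<le> exp \<epsilon> * pmf Q1 i" "pmf Q1 i \<le> exp \<epsilon> * pmf Q0 i"
      by (auto simp: Q0 Q1 near_uniform_def q_def mult.commute)
  qed
  then have dp: "pure_dp \<epsilon> Q0 Q1"
    by (simp add: pure_dp_def max_divergence_le)
  have "(MIN i\<in>{1..n}. pmf Q0 i) = \<beta>"
  proof (rule Min_eqI)
    show "\<beta> \<in> pmf Q0 ` {1..n}"
      using n by (intro image_eqI[of _ _ 1]) (auto simp: Q0 near_uniform_def)
  qed (use bounds in auto)
  moreover have "(MIN i\<in>{1..n}. pmf Q1 i) \<ge> \<beta>"
    using n bounds by (subst Min_ge_iff) auto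
  ultimately have min: "min_prob n Q0 Q1 = \<beta>"
    by (simp add: min_prob_def)
  have far: "far_from_pure_dp \<alpha> \<epsilon> P0 Q1"
    by (rule far_from_pure_dpI[of _ 1 _ \<beta>]) (use \<alpha> \<beta> in \<open>auto simp: P0 Q1 near_uniform_def \<eta>_def\<close>)
  \<comment> \<open>Full support gives the support inclusion for \<open>P0\<close>, even when
    \<open>P0\<close> loses point 1.\<close>
  have set_Q0: "set_pmf Q0 = {1..n}"
    using Q0(2) bounds(1) \<beta> by (force simp: distribution_on_def set_pmf_iff)
  \<comment> \<open>Only points 1 and 2 differ, each by \<eta> \<beta>, and each has mass at least
    \<beta> under \<open>Q0\<close>.\<close>
  have "(\<Sum>x\<in>{3..n}. (pmf P0 x - pmf Q0 x)\<^sup>2 / pmf Q0 x) = 0"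
    by (intro sum.neutral) (auto simp: P0 Q0 near_uniform_def)
  then have "(\<Sum>x\<in>set_pmf Q0. (pmf P0 x - pmf Q0 x)\<^sup>2 / pmf Q0 x) =
      (\<eta> * \<beta>)\<^sup>2 / pmf Q0 1 + (\<eta> * \<beta>)\<^sup>2 / pmf Q0 2"
    unfolding set_Q0 atLeastAtMost_split_1_2[OF n]
    by simp (simp add: P0 Q0 near_uniform_def algebra_simps power2_eq_square)
  also have "\<dots> \<le> (\<eta> * \<beta>)\<^sup>2 / \<beta> + (\<eta> * \<beta>)\<^sup>2 / \<beta>"
    using bounds(1)[of 1] bounds(1)[of 2] n \<beta>
    by (intro add_mono divide_left_mono) auto
  also have "\<dots> = 2 * (\<beta> * \<eta>\<^sup>2)"
    using \<beta> by (simp add: power2_eq_square)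
  also have "\<dots> \<le> 2 * (\<beta> * \<alpha>\<^sup>2)"
    using \<eta> \<beta> by (simp add: power_mono)
  finally have chi: "(\<Sum>x\<in>set_pmf Q0. (pmf P0 x - pmf Q0 x)\<^sup>2 / pmf Q0 x) \<le> 2 * (\<beta> * \<alpha>\<^sup>2)" .
  have "1 / 20 / (\<beta> * \<alpha>\<^sup>2) \<le> real r" if T: "pure_dp_tester n \<epsilon> \<alpha> Q0 Q1 r T" for r T
  proof -
    \<comment> \<open>The second database follows \<open>Q1\<close> in both scenarios, so its
      samples are averaged into the randomness of the test.\<close>
    define f where "f = (\<lambda>xs. pmf (bind_pmf (replicate_pmf r Q1) (\<lambda>ys. T xs ys)) True)"
    have verdict: "pmf (verdict T r P Q1) True = measure_pmf.expectation (replicate_pmf r P) f" for P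
      by (simp add: verdict_def pmf_bind[of "replicate_pmf r P"] f_def)
    have "pmf (verdict T r Q0 Q1) True \<ge> 2 / 3" "pmf (verdict T r P0 Q1) False \<ge> 2 / 3"
      using T dp far Q0 Q1 P0 by (auto simp: pure_dp_tester_def)
    then have "1 / 10 \<le> real r * (\<Sum>x\<in>set_pmf Q0. (pmf P0 x - pmf Q0 x)\<^sup>2 / pmf Q0 x)"
      using P0(2)
      by (intro sample_size_ge_chi_square[where f = f])
        (auto simp: set_Q0 distribution_on_def f_def[THEN fun_cong] pmf_le_1 pmf_False_conv_True
          simp flip: verdict)
    also have "\<dots> \<le> real r * (2 * (\<beta> * \<alpha>\<^sup>2))"
      using chi by (intro mult_left_mono) auto
    finally show ?thesis
      using \<alpha> \<beta> by (simp add: field_simps)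
  qed
  then show "\<exists>Q0 Q1. distribution_on n Q0 \<and> distribution_on n Q1 \<and> pure_dp \<epsilon> Q0 Q1 \<and>
      min_prob n Q0 Q1 = \<beta> \<and>
      (\<forall>r T. pure_dp_tester n \<epsilon> \<alpha> Q0 Q1 r T \<longrightarrow> 1 / 20 / (\<beta> * \<alpha>\<^sup>2) \<le> real r)"
    using Q0(2) Q1(2) dp min by blast
qed

end
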